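(* Let $q$ be a complex number with $|q|<1$. Then $$\sum_{n=1}^{\infty}\frac{q^n}{(1-q^n)^2(q^{n+1};q)_n(q^{2n+2};q^2)_{\infty}}=\frac{1}{(q^2;q^2)_{\infty}}\sum_{n=1}^{\infty}\frac{nq^n}{1-q^n}+\frac{1}{(q^2;q^2)_{\infty}}\sum_{n=1}^{\infty}\frac{(-1)^n(1+q^{2n})q^{n(3n+1)}}{(1-q^{2n})^2}.$$
   Context: Notation: $(a;q)_n:=\prod_{j=0}^{n-1}(1-aq^j)$ for $n\ge 0$ (empty product equal to 1) and $(a;q)_\infty:=\lim_{n\to\infty}(a;q)_n$. *)

theory Defs
  imports "HOL-Analysis.Analysis"
begin

definition qpoch :: "complex \<Rightarrow> complex \<Rightarrow> nat \<Rightarrow> complex" where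
  "qpoch a q n = (\<Prod>j<n. 1 - a * q ^ j)"

definition qpoch_inf :: "complex \<Rightarrow> complex \<Rightarrow> complex" where
  "qpoch_inf a q = lim (\<lambda>n. qpoch a q n)"

text \<open>
  The value of \<^const>\<open>lim\<close> is meaningful here, since the limit exists whenever the base
  lies in the open unit disc.
\<close>

lemma qpoch_tendsto_qpoch_inf:
  assumes "norm q < 1"
  shows "(\<lambda>n. qpoch a q n) \<longlonglongrightarrow> qpoch_inf a q"
proof -
  have "summable (\<lambda>j. norm a * norm q ^ j)"
    using assms by (intro summable_mult summable_geometric) auto
  hence "summable (\<lambda>j. norm ((1 - a * q ^ j) - 1))"
    by (simp add: norm_mult norm_power)
  hence "convergent_prod (\<lambda>j. 1 - a * q ^ j)"
    by (intro abs_convergent_prod_imp_convergent_prod summable_imp_abs_convergent_prod)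
  hence "convergent (\<lambda>n. \<Prod>j\<le>n. 1 - a * q ^ j)"
    by (rule convergent_prod_imp_convergent)
  hence "convergent (\<lambda>n. qpoch a q (Suc n))"
    by (simp add: qpoch_def lessThan_Suc_atMost)
  hence "convergent (\<lambda>n. qpoch a q n)"
    by (subst (asm) convergent_Suc_iff)
  thus ?thesis
    by (simp add: qpoch_inf_def convergent_LIMSEQ_iff)
qed

end

theory Submission
  imports Defs
begin

text \<open>
  The sequences \<open>\<alpha>\<^sub>2\<^sub>n = (-1)\<^sup>n q\<^bsup>n(3n-1)\<^esup> (1 + q\<^bsup>2n\<^esup>)\<close>, \<open>\<alpha>\<^sub>0 = 1\<close>,
  \<open>\<alpha>\<^sub>2\<^sub>n\<^sub>+\<^sub>1 = 0\<close> and \<open>\<beta>\<^sub>n = (q\<^sup>2;q\<^sup>2)\<^sub>n / ((q)\<^sub>n (q)\<^sub>2\<^sub>n)\<close> form a Bailey pair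
  relative to \<open>1\<close>, and up to the factor \<open>1 / (q\<^sup>2;q\<^sup>2)\<^sub>\<infinity>\<close> the left-hand side is
  \<open>\<Sum> (q)\<^sub>n\<^sub>-\<^sub>1\<^sup>2 q\<^sup>n \<beta>\<^sub>n\<close>. This is the second-order term at \<open>z = 1\<close> of Bailey's lemma with
  parameters \<open>z, 1/z\<close>. No limit in \<open>z\<close> is needed, however: expanding \<open>\<beta>\<^sub>n\<close> and summing over
  \<open>n \<le> N\<close> first, every inner sum telescopes in closed form. The term \<open>\<alpha>\<^sub>0\<close> yields
  \<open>\<Sum> q\<^sup>n / (1 - q\<^sup>n)\<^sup>2\<close>, a rearrangement of the Lambert series, and \<open>\<alpha>\<^sub>2\<^sub>j\<close> yields the \<open>j\<close>-th
  term of the last series times a bounded factor tending to \<open>1\<close>, so that Tannery's theorem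
  gives the limit \<open>N \<rightarrow> \<infinity>\<close>.
\<close>

section \<open>The Bailey kernel and the Bailey pair\<close>

text \<open>The weight 1 / ((q)_{n-k} (aq)_{n+k}) of Bailey pairs at a = 1. The value 0 for
  \<open>k > n\<close> encodes the convention 1 / (q)_{-m} = 0 for m > 0, so the recurrences need no
  range condition and sums may run past \<open>n\<close>.\<close>

definition bailey_kernel :: "complex \<Rightarrow> nat \<Rightarrow> nat \<Rightarrow> complex" where
  "bailey_kernel q n k = (if k \<le> n then 1 / (qpoch q q (n - k) * qpoch q q (n + k)) else 0)"

text \<open>Only the even-indexed entries of the pair are kept: index \<open>n\<close> stands for \<open>\<alpha>\<^sub>2\<^sub>n\<close>.\<close>

definition bailey_alpha :: "complex \<Rightarrow> nat \<Rightarrow> complex" where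
  "bailey_alpha q n = (if n = 0 then 1 else (-1) ^ n * q ^ (n * (3 * n - 1)) * (1 + q ^ (2 * n)))"

definition bailey_beta :: "complex \<Rightarrow> nat \<Rightarrow> complex" where
  "bailey_beta q n = qpoch (q\<^sup>2) (q\<^sup>2) n / (qpoch q q n * qpoch q q (2 * n))"

section \<open>Finite and infinite q-shifted factorials\<close>

lemma qpoch_0 [simp]: "qpoch a q 0 = 1"
  by (simp add: qpoch_def)

lemma qpoch_Suc: "qpoch a q (Suc n) = qpoch a q n * (1 - a * q ^ n)"
  by (simp add: qpoch_def)

lemma qpoch_add: "qpoch a q (m + n) = qpoch a q m * qpoch (a * q ^ m) q n"
  by (induction n) (simp_all add: qpoch_Suc power_add mult.assoc)

lemma one_minus_power_nonzero:
  fixes q :: complex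
  assumes "norm q < 1" "n > 0"
  shows "1 - q ^ n \<noteq> 0"
proof
  assume "1 - q ^ n = 0"
  hence "norm q ^ n = 1" by (metis norm_one norm_power right_minus_eq)
  moreover have "norm q ^ n \<le> norm q ^ 1"
    using assms by (intro power_decreasing) auto
  ultimately show False using assms by simp
qed

lemma qpoch_nonzero:
  assumes "norm a < 1" "norm q < 1"
  shows "qpoch a q n \<noteq> 0"
proof -
  have "1 - a * q ^ j \<noteq> 0" for j
  proof
    assume "1 - a * q ^ j = 0"
    hence "norm a * norm q ^ j = 1" by (metis norm_one norm_mult norm_power right_minus_eq)
    moreover have "norm a * norm q ^ j \<le> norm a * 1"
      using assms by (intro mult_left_mono power_le_one) auto
    ultimately show False using assms by simp
  qed
  thus ?thesis by (simp add: qpoch_def)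
qed

text \<open>An absolutely convergent product without zero factors has a nonzero limit.\<close>

lemma qpoch_inf_nonzero:
  assumes "norm a < 1" "norm q < 1"
  shows "qpoch_inf a q \<noteq> 0"
proof -
  have nz: "1 - a * q ^ j \<noteq> 0" for j
    using qpoch_nonzero[OF assms, of "Suc j"] by (auto simp: qpoch_Suc)
  have "summable (\<lambda>j. norm a * norm q ^ j)"
    using assms by (intro summable_mult summable_geometric) auto
  hence "summable (\<lambda>j. norm ((1 - a * q ^ j) - 1))"
    by (simp add: norm_mult norm_power)
  hence "convergent_prod (\<lambda>j. 1 - a * q ^ j)"
    by (intro abs_convergent_prod_imp_convergent_prod summable_imp_abs_convergent_prod)
  then obtain L where L: "L \<noteq> 0" "(\<lambda>n. \<Prod>j\<le>n. 1 - a * q ^ j) \<longlonglongrightarrow> L"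
    using convergent_prod_iff_nz_lim[of "\<lambda>j. 1 - a * q ^ j"] nz by auto
  have "(\<lambda>n. qpoch a q (Suc n)) \<longlonglongrightarrow> L"
    using L(2) by (simp add: qpoch_def lessThan_Suc_atMost)
  hence "(\<lambda>n. qpoch a q n) \<longlonglongrightarrow> L"
    by (simp add: filterlim_sequentially_Suc)
  with qpoch_tendsto_qpoch_inf[OF assms(2)] L(1) show ?thesis
    using LIMSEQ_unique by blast
qed

lemma qpoch_inf_split:
  assumes "norm q < 1"
  shows "qpoch_inf a q = qpoch a q n * qpoch_inf (a * q ^ n) q"
proof (rule LIMSEQ_unique)
  show "(\<lambda>m. qpoch a q (m + n)) \<longlonglongrightarrow> qpoch_inf a q"
    by (rule LIMSEQ_ignore_initial_segment) (rule qpoch_tendsto_qpoch_inf[OF assms])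
  have "(\<lambda>m. qpoch a q n * qpoch (a * q ^ n) q m) \<longlonglongrightarrow> qpoch a q n * qpoch_inf (a * q ^ n) q"
    by (intro tendsto_mult tendsto_const qpoch_tendsto_qpoch_inf[OF assms])
  thus "(\<lambda>m. qpoch a q (m + n)) \<longlonglongrightarrow> qpoch a q n * qpoch_inf (a * q ^ n) q"
    by (subst add.commute) (simp add: qpoch_add)
qed

section \<open>Recurrences of the kernel and the telescoping inner sum\<close>

lemma bailey_kernel_eq_0: "k > n \<Longrightarrow> bailey_kernel q n k = 0"
  by (simp add: bailey_kernel_def)

text \<open>For \<open>k \<le> n\<close> the two kernels differ by the factors 1 - q^(n+1-k) and 1 -
  q^(n+1+k). Multiplying by \<open>q ^ k\<close> turns the first into
  \<open>q ^ k - q ^ Suc n\<close>, which avoids truncated subtraction and makes both sides vanish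
  at \<open>k = Suc n\<close>.\<close>

lemma bailey_kernel_Suc_left:
  assumes "norm q < 1"
  shows "q ^ k * bailey_kernel q n k =
           (q ^ k - q ^ Suc n) * (1 - q ^ (Suc n + k)) * bailey_kernel q (Suc n) k"
proof (cases "k \<le> n")
  case True
  then obtain d where n: "n = k + d" by (auto simp: le_iff_add)
  have nz: "qpoch q q (d + 2 * k) \<noteq> 0" "qpoch q q d \<noteq> 0"
    "1 - q ^ Suc d \<noteq> 0" "1 - q ^ Suc (d + 2 * k) \<noteq> 0"
    using assms qpoch_nonzero one_minus_power_nonzero by blast+
  have idx: "n - k = d" "n + k = d + 2 * k" "Suc n - k = Suc d" "Suc n + k = Suc (d + 2 * k)"
    by (simp_all add: n)
  have k1: "bailey_kernel q n k = 1 / (qpoch q q d * qpoch q q (d + 2 * k))"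
    unfolding bailey_kernel_def idx using True by simp
  have k2: "bailey_kernel q (Suc n) k = 1 / (qpoch q q d * (1 - q ^ Suc d) *
      (qpoch q q (d + 2 * k) * (1 - q ^ Suc (d + 2 * k))))"
    unfolding bailey_kernel_def idx using True by (simp add: qpoch_Suc)
  have k3: "q ^ k - q ^ Suc n = q ^ k * (1 - q ^ Suc d)"
    by (simp_all add: n power_add algebra_simps)
  show ?thesis
    unfolding k1 k2 k3 idx using nz by simp
next
  case False
  hence "k = Suc n \<or> k > Suc n" by auto
  thus ?thesis using False by (auto simp: bailey_kernel_eq_0)
qed

lemma bailey_kernel_Suc_right:
  assumes "norm q < 1"
  shows "q ^ k * (1 - q ^ Suc (n + k)) * bailey_kernel q n (Suc k) =
           (q ^ k - q ^ n) * bailey_kernel q n k"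
proof (cases "Suc k \<le> n")
  case True
  then obtain d where n: "n = Suc (k + d)" by (auto simp: le_iff_add)
  have nz: "qpoch q q (Suc (d + 2 * k)) \<noteq> 0" "qpoch q q d \<noteq> 0"
    "1 - q ^ Suc d \<noteq> 0" "1 - q ^ Suc (Suc (d + 2 * k)) \<noteq> 0"
    using assms qpoch_nonzero one_minus_power_nonzero by blast+
  have idx: "n - k = Suc d" "n + k = Suc (d + 2 * k)" "n - Suc k = d"
      "n + Suc k = Suc (Suc (d + 2 * k))"
    by (simp_all add: n)
  have k1: "bailey_kernel q n k = 1 / (qpoch q q d * (1 - q ^ Suc d) * qpoch q q (Suc (d + 2 * k)))"
    unfolding bailey_kernel_def idx qpoch_Suc[of _ _ d] using True by simp
  have k2: "bailey_kernel q n (Suc k) = 1 / (qpoch q q d *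
      (qpoch q q (Suc (d + 2 * k)) * (1 - q ^ Suc (Suc (d + 2 * k)))))"
    unfolding bailey_kernel_def idx qpoch_Suc[of _ _ "Suc (d + 2 * k)"] using True by simp
  have k3: "q ^ k - q ^ n = q ^ k * (1 - q ^ Suc d)"
    by (simp_all add: n power_add algebra_simps)
  show ?thesis
    unfolding k1 k2 k3 idx using nz by simp
next
  case False
  hence "k = n \<or> k > n" by auto
  thus ?thesis using False by (auto simp: bailey_kernel_eq_0)
qed

text \<open>With x = \<open>q ^ k\<close> and y = \<open>q ^ Suc N\<close>, the induction step is
  the identity (x - y)(1 - xy) + (1 - x)^2 y = x (1 - y)^2. The base case needs
  \<open>k > 0\<close>, as \<open>bailey_kernel q 0 0 = 1\<close>.\<close>

lemma sum_bailey_kernel: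
  assumes "norm q < 1" "k > 0"
  shows "(1 - q ^ k)\<^sup>2 * (\<Sum>n<N. qpoch q q n ^ 2 * q ^ Suc n * bailey_kernel q (Suc n) k) =
           q ^ k * qpoch q q N ^ 2 * bailey_kernel q N k"
proof (induction N)
  case 0
  then show ?case using assms by (simp add: bailey_kernel_eq_0)
next
  case (Suc N)
  have "(1 - q ^ k)\<^sup>2 * (\<Sum>n<Suc N. qpoch q q n ^ 2 * q ^ Suc n * bailey_kernel q (Suc n) k) =
     qpoch q q N ^ 2 * (q ^ k * bailey_kernel q N k) +
     (1 - q ^ k)\<^sup>2 * (qpoch q q N ^ 2 * q ^ Suc N * bailey_kernel q (Suc N) k)"
    unfolding sum.lessThan_Suc distrib_left Suc.IH by (simp only: mult_ac)
  also have "\<dots> = qpoch q q N ^ 2 * bailey_kernel q (Suc N) k *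
     ((q ^ k - q ^ Suc N) * (1 - q ^ Suc N * q ^ k) + (1 - q ^ k)\<^sup>2 * q ^ Suc N)"
    unfolding bailey_kernel_Suc_left[OF assms(1)] power_add by (simp add: algebra_simps del: power_Suc)
  also have "\<dots> = qpoch q q N ^ 2 * bailey_kernel q (Suc N) k * (q ^ k * (1 - q ^ Suc N)\<^sup>2)"
    by (simp add: power2_eq_square algebra_simps del: power_Suc)
  also have "\<dots> = q ^ k * qpoch q q (Suc N) ^ 2 * bailey_kernel q (Suc N) k"
    by (simp add: qpoch_Suc power_mult_distrib)
  finally show ?case .
qed

section \<open>Rearranging the Lambert series\<close>

text \<open>Both series are iterated sums of m q^(nm) over n, m \<ge> 1: summing over m first gives
  q^n / (1 - q^n)^2, summing over n first gives m q^m / (1 - q^m). Absolute convergence of the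
  double family permits either order.\<close>

lemma sum_n_pow_div_eq_Lambert:
  fixes q :: complex
  assumes "norm q < 1"
  obtains S where "(\<lambda>n. q ^ Suc n / (1 - q ^ Suc n)\<^sup>2) sums S"
    "(\<lambda>n. of_nat (Suc n) * q ^ Suc n / (1 - q ^ Suc n)) sums S"
proof -
  define f :: "nat \<times> nat \<Rightarrow> complex" where
    "f = (\<lambda>(n, m). of_nat (Suc m) * q ^ (Suc n * Suc m))"
  define r where "r = norm q"
  have r: "0 \<le> r" "r < 1" using assms by (auto simp: r_def)
  \<comment> \<open>Product majorant for \<open>norm (f (n, m))\<close>, available because
    (n+1)(m+1) \<ge> n + m.\<close>
  have "(\<lambda>(n, m). r ^ n * (real (Suc m) * r ^ m)) summable_on Sigma UNIV (\<lambda>_. UNIV)"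
  proof (rule summable_on_SigmaI)
    fix n :: nat
    have "(\<lambda>m. real (Suc m) * r ^ m) sums (1 / (1 - r)\<^sup>2)"
      using geometric_deriv_sums[of r] r by simp
    hence "((\<lambda>m. real (Suc m) * r ^ m) has_sum (1 / (1 - r)\<^sup>2)) UNIV"
      using r by (intro sums_nonneg_imp_has_sum) auto
    thus "((\<lambda>m. case (n, m) of (n, m) \<Rightarrow> r ^ n * (real (Suc m) * r ^ m)) has_sum
        (r ^ n * (1 / (1 - r)\<^sup>2))) UNIV"
      unfolding case_prod_conv by (rule has_sum_cmult_right)
  next
    show "(\<lambda>n. r ^ n * (1 / (1 - r)\<^sup>2)) summable_on UNIV"
      using r by (intro summable_on_cmult_left norm_summable_imp_summable_on)
        (auto intro: summable_geometric)
  qed (use r in auto)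
  moreover have "norm (f p) \<le> (case p of (n, m) \<Rightarrow> r ^ n * (real (Suc m) * r ^ m))" for p
  proof -
    obtain n m where p: "p = (n, m)" by force
    have "r ^ (Suc n * Suc m) \<le> r ^ (n + m)"
      using r by (intro power_decreasing) auto
    hence "real (Suc m) * r ^ (Suc n * Suc m) \<le> real (Suc m) * r ^ (n + m)"
      by (intro mult_left_mono) auto
    moreover have "norm (f p) = real (Suc m) * r ^ (Suc n * Suc m)"
      unfolding p f_def case_prod_conv norm_mult norm_power norm_of_nat r_def ..
    ultimately show ?thesis by (simp add: p power_add mult_ac)
  qed
  ultimately have "(\<lambda>p. norm (f p)) summable_on UNIV \<times> UNIV"
    by (intro Infinite_Sum.abs_summable_on_comparison_test'[where f = f]) auto
  then obtain S where S: "(f has_sum S) (UNIV \<times> UNIV)"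
    using abs_summable_summable summable_on_def by blast
  have lt: "norm (q ^ Suc n) < 1" for n
    using r power_Suc_less_one[of r n] by (cases "r = 0") (auto simp: norm_power r_def simp del: power_Suc)
  have "((\<lambda>n. q ^ Suc n / (1 - q ^ Suc n)\<^sup>2) has_sum S) UNIV"
  proof (rule has_sum_SigmaD[OF S])
    fix n
    let ?x = "q ^ Suc n"
    have "(\<lambda>m. of_nat (Suc m) * ?x ^ m) sums (1 / (1 - ?x)\<^sup>2)"
      by (rule geometric_deriv_sums[OF lt])
    hence "(\<lambda>m. of_nat (Suc m) * ?x ^ m * ?x) sums (1 / (1 - ?x)\<^sup>2 * ?x)"
      by (rule sums_mult2)
    moreover have "of_nat (Suc m) * ?x ^ m * ?x = f (n, m)" for m
      unfolding f_def case_prod_conv power_mult by simp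
    ultimately have "(\<lambda>m. f (n, m)) sums (?x / (1 - ?x)\<^sup>2)" by simp
    \<comment> \<open>A \<open>sums\<close> fact alone gives no unordered sum; summability of the
      row is inherited from the double family, and uniqueness of limits then identifies the
      value.\<close>
    moreover have "(\<lambda>m. f (n, m)) summable_on UNIV"
      using summable_on_SigmaD1[of "\<lambda>n m. f (n, m)" UNIV "\<lambda>_. UNIV" n] S
      by (auto simp: summable_on_def)
    ultimately show "((\<lambda>m. f (n, m)) has_sum (?x / (1 - ?x)\<^sup>2)) UNIV"
      by (metis has_sum_imp_sums has_sum_infsum sums_unique2)
  qed
  moreover have "((\<lambda>n. of_nat (Suc n) * q ^ Suc n / (1 - q ^ Suc n)) has_sum S) UNIV"
  proof (rule has_sum_SigmaD[OF S[THEN has_sum_swap[THEN iffD1]]])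
    fix m
    let ?x = "q ^ Suc m"
    have "(\<lambda>n. of_nat (Suc m) * ?x * ?x ^ n) sums (of_nat (Suc m) * ?x * (1 / (1 - ?x)))"
      by (intro sums_mult geometric_sums lt)
    moreover have "of_nat (Suc m) * ?x * ?x ^ n = f (n, m)" for n
    proof -
      have "q ^ (Suc n * Suc m) = ?x ^ Suc n"
        by (subst mult.commute) (rule power_mult)
      thus ?thesis
        unfolding f_def case_prod_conv by (simp only: power_Suc[of "q ^ Suc m"] mult.assoc)
    qed
    ultimately have "(\<lambda>n. f (n, m)) sums (of_nat (Suc m) * ?x / (1 - ?x))" by simp
    moreover have "(\<lambda>n. f (n, m)) summable_on UNIV"
      using summable_on_SigmaD1[of "\<lambda>m n. f (n, m)" UNIV "\<lambda>_. UNIV" m]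
        S[THEN has_sum_swap[THEN iffD1]]
      by (auto simp: summable_on_def)
    ultimately show "((\<lambda>n. case (m, n) of (x, y) \<Rightarrow> f (y, x)) has_sum (of_nat (Suc m) * ?x / (1 - ?x))) UNIV"
      by (simp only: case_prod_conv) (metis has_sum_imp_sums has_sum_infsum sums_unique2)
  qed
  ultimately show ?thesis using that has_sum_imp_sums by blast
qed

section \<open>Verifying the Bailey pair by creative telescoping\<close>

lemma bailey_alpha_Suc:
  "bailey_alpha q (Suc n) = (-1) ^ Suc n * q ^ (Suc n * (3 * n + 2)) * (1 + q ^ (2 * n + 2))"
  by (simp add: bailey_alpha_def algebra_simps)

text \<open>The factor 1 - q^(2n+2) gained by (q^2;q^2)_{n+1} cancels one of the two factors gained
  by (q)_{2n+2}.\<close>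

lemma bailey_beta_Suc:
  assumes "norm q < 1"
  shows "(1 - q ^ Suc n) * (1 - q ^ (2 * n + 1)) * bailey_beta q (Suc n) = bailey_beta q n"
proof -
  have nz: "qpoch q q m \<noteq> 0" "1 - q ^ Suc m \<noteq> 0" for m
    using assms qpoch_nonzero one_minus_power_nonzero by blast+
  have "qpoch (q\<^sup>2) (q\<^sup>2) (Suc n) = qpoch (q\<^sup>2) (q\<^sup>2) n * (1 - q ^ Suc (Suc (2 * n)))"
    by (simp add: qpoch_Suc power_mult power2_eq_square)
  moreover have "qpoch q q (2 * Suc n) =
      qpoch q q (2 * n) * (1 - q ^ Suc (2 * n)) * (1 - q ^ Suc (Suc (2 * n)))"
    by (simp add: qpoch_Suc)
  moreover have "qpoch q q (Suc n) = qpoch q q n * (1 - q ^ Suc n)"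
    by (simp add: qpoch_Suc)
  moreover have "2 * n + 1 = Suc (2 * n)" by simp
  ultimately show ?thesis
    unfolding bailey_beta_def using nz[of n] nz[of "2 * n"] nz[of "Suc (2 * n)"]
    by (simp only: divide_simps) simp
qed

text \<open>
  The right-hand side is the certificate of creative telescoping: the recurrence in \<open>N\<close>
  satisfied by \<^const>\<open>bailey_beta\<close> holds for the summands up to a difference in \<open>n\<close>.
\<close>

lemma bailey_pair_telescope:
  assumes "norm q < 1" "q \<noteq> 0"
  shows "(\<Sum>n\<le>K. bailey_alpha q n *
             ((1 - q ^ Suc N) * (1 - q ^ (2 * N + 1)) * bailey_kernel q (Suc N) (2 * n)
              - bailey_kernel q N (2 * n))) =
         (-1) ^ K * q ^ (Suc N + 3 * K * Suc K) * (1 - q ^ (N + 2 * K + 3)) * (1 - q ^ (N + 2 * K + 2))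
           * bailey_kernel q (Suc N) (2 * K + 2)"
proof (induction K)
  case 0
  let ?R = "bailey_kernel q (Suc N)"
  have a: "bailey_kernel q N 0 = (1 - q ^ Suc N) * (1 - q ^ Suc N) * ?R 0"
    using bailey_kernel_Suc_left[OF assms(1), of 0 N] by simp
  have b: "(1 - q ^ (N + 2)) * ?R 1 = (1 - q ^ Suc N) * ?R 0"
    using bailey_kernel_Suc_right[OF assms(1), of 0 "Suc N"] by simp
  have "q * ((1 - q ^ (N + 3)) * ?R 2) = q * ((1 - q ^ N) * ?R 1)"
    using bailey_kernel_Suc_right[OF assms(1), of 1 "Suc N"]
    by (simp add: numeral_2_eq_2 numeral_3_eq_3 algebra_simps)
  hence c: "(1 - q ^ (N + 3)) * ?R 2 = (1 - q ^ N) * ?R 1"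
    using assms(2) by (simp only: mult_left_cancel not_False_eq_True)
  have p: "q ^ (2 * N + 1) = q ^ N * q ^ Suc N"
    by (simp add: mult_2 power_add)
  \<comment> \<open>Two right recurrences carry \<open>?R 2\<close> back to \<open>?R 0\<close> and
    absorb the two linear factors of the certificate.\<close>
  have "q ^ Suc N * (1 - q ^ (N + 3)) * (1 - q ^ (N + 2)) * ?R 2 =
      q ^ Suc N * (1 - q ^ (N + 2)) * ((1 - q ^ (N + 3)) * ?R 2)" by (simp only: mult_ac)
  also have "\<dots> = q ^ Suc N * (1 - q ^ N) * ((1 - q ^ (N + 2)) * ?R 1)"
    unfolding c by (simp only: mult_ac)
  also have "\<dots> = q ^ Suc N * (1 - q ^ N) * (1 - q ^ Suc N) * ?R 0"
    unfolding b by (simp only: mult_ac)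
  also have "\<dots> = (1 - q ^ Suc N) * (1 - q ^ (2 * N + 1)) * ?R 0 - bailey_kernel q N 0"
    unfolding a p by (simp add: algebra_simps del: power_Suc)
  finally show ?case by (simp add: bailey_alpha_def flip: numeral_2_eq_2)
next
  case (Suc K)
  \<comment> \<open>These abbreviations turn the induction step into a polynomial identity in
    \<open>q\<close>, \<open>x\<close>, \<open>y\<close>: \<open>e\<close> collects the sign and the
    quadratic power, \<open>u\<close> and \<open>v\<close> the linear factors of the certificate at
    \<open>K\<close> and \<open>Suc K\<close>.\<close>
  define x where "x = q ^ (2 * K + 2)"
  define y where "y = q ^ Suc N"
  define e where "e = (-1 :: complex) ^ K * q ^ (3 * K * Suc K)"
  define u where "u = (1 - q ^ (N + 2 * K + 3)) * (1 - q ^ (N + 2 * K + 2))"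
  define v where "v = (1 - q ^ (N + 2 * Suc K + 3)) * (1 - q ^ (N + 2 * Suc K + 2))"
  let ?R = "bailey_kernel q (Suc N)"
  have x0: "x \<noteq> 0" using assms by (simp add: x_def)
  have "Suc K * (3 * K + 2) = 3 * K * Suc K + (2 * K + 2)" by (simp add: algebra_simps)
  hence "q ^ (Suc K * (3 * K + 2)) = q ^ (3 * K * Suc K) * x"
    by (simp only: power_add x_def)
  hence al: "bailey_alpha q (Suc K) = - (e * x * (1 + x))"
    by (simp add: bailey_alpha_Suc e_def x_def power_Suc[of "-1"] del: power_Suc mult_Suc mult_Suc_right)
  have xy: "q ^ (Suc N + (2 * K + 2)) = x * y" "q ^ (N + 2 * K + 3) = x * y"
    "q * q ^ (N + 2 * K + 2) = x * y"
    unfolding x_def y_def power_add [symmetric] power_Suc [symmetric]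
    by (rule arg_cong[of _ _ "(^) q"]; simp)+
  have "q * u = (1 - x * y) * (q - q * q ^ (N + 2 * K + 2))"
    unfolding u_def xy(2) by (simp add: algebra_simps)
  hence u: "q * u = (1 - x * y) * (q - x * y)" unfolding xy(3) .
  have k: "x * bailey_kernel q N (2 * K + 2) = (x - y) * (1 - x * y) * ?R (2 * K + 2)"
    using bailey_kernel_Suc_left[OF assms(1), of "2 * K + 2" N] unfolding xy(1)
    unfolding x_def y_def .
  have i: "Suc (2 * K + 2) = 2 * K + 3" "Suc (2 * K + 3) = 2 * K + 4"
    "Suc (Suc N + (2 * K + 2)) = N + 2 * Suc K + 2" "Suc (Suc N + (2 * K + 3)) = N + 2 * Suc K + 3"
    by simp_all
  have r1: "x * (1 - q ^ (N + 2 * Suc K + 2)) * ?R (2 * K + 3) = (x - y) * ?R (2 * K + 2)"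
    using bailey_kernel_Suc_right[OF assms(1), of "2 * K + 2" "Suc N"] unfolding i
    unfolding x_def y_def .
  have "q ^ (2 * K + 3) = q * x" by (simp only: x_def power_Suc [symmetric] i)
  hence r2: "q * x * (1 - q ^ (N + 2 * Suc K + 3)) * ?R (2 * K + 4) = (q * x - y) * ?R (2 * K + 3)"
    using bailey_kernel_Suc_right[OF assms(1), of "2 * K + 3" "Suc N"] unfolding i
    by (simp only: y_def)
  \<comment> \<open>Two right recurrences reduce index \<open>2 * K + 4\<close> to
    \<open>2 * K + 2\<close>, so that all terms share one kernel value.\<close>
  have v: "q * x\<^sup>2 * (v * ?R (2 * K + 4)) = (q * x - y) * (x - y) * ?R (2 * K + 2)"
  proof -
    have "q * x\<^sup>2 * (v * ?R (2 * K + 4)) = x * (1 - q ^ (N + 2 * Suc K + 2)) *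
        (q * x * (1 - q ^ (N + 2 * Suc K + 3)) * ?R (2 * K + 4))"
      by (simp only: v_def power2_eq_square mult_ac)
    also have "\<dots> = (q * x - y) * (x * (1 - q ^ (N + 2 * Suc K + 2)) * ?R (2 * K + 3))"
      unfolding r2 by (simp only: mult_ac)
    finally show ?thesis unfolding r1 by (simp only: mult_ac)
  qed
  have yy: "q * q ^ (2 * N + 1) = y * y"
    by (simp add: y_def mult_2 power_add)
  let ?A = "(1 - y) * (1 - q ^ (2 * N + 1)) * ?R (2 * K + 2)"
  \<comment> \<open>Multiplying by \<open>q * x\<close> makes \<open>u\<close>,
    \<open>q ^ (2 * N + 1)\<close> and the kernel at \<open>N\<close> expressible through
    \<open>x\<close>, \<open>y\<close> and \<open>?R (2 * K + 2)\<close>; the factor is cancelled at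
    the end.\<close>
  have "q * x * (e * y * u * ?R (2 * K + 2)
        + (- (e * x * (1 + x))) * (?A - bailey_kernel q N (2 * K + 2)))
     = e * x * y * (q * u) * ?R (2 * K + 2)
       - e * x * (1 + x) * (x * (1 - y) * (q - q * q ^ (2 * N + 1)) * ?R (2 * K + 2)
           - q * (x * bailey_kernel q N (2 * K + 2)))"
    by (simp add: algebra_simps del: power_Suc)
  also have "\<dots> = e * x * ?R (2 * K + 2) * (y * ((1 - x * y) * (q - x * y))
       - (1 + x) * (x * (1 - y) * (q - y * y) - q * ((x - y) * (1 - x * y))))"
    unfolding u yy k by (simp add: algebra_simps)
  also have "\<dots> = - e * x * y * x * ((q * x - y) * (x - y) * ?R (2 * K + 2))"
    by (simp add: algebra_simps)
  also have "\<dots> = q * x * (- e * y * x ^ 3 * v * ?R (2 * K + 4))"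
    unfolding v [symmetric] by (simp add: power2_eq_square power3_eq_cube)
  finally have step: "e * y * u * ?R (2 * K + 2)
        + (- (e * x * (1 + x))) * (?A - bailey_kernel q N (2 * K + 2)) = - e * y * x ^ 3 * v * ?R (2 * K + 4)"
    using x0 assms(2) by (metis mult_left_cancel no_zero_divisors)
  have pre: "(-1) ^ K * q ^ (Suc N + 3 * K * Suc K) = e * y"
    by (simp add: e_def y_def power_add)
  \<comment> \<open>The exponent grows by 3(2K+2) from \<open>K\<close> to \<open>Suc K\<close>,
    which accounts for \<open>x ^ 3\<close>.\<close>
  have "(3::nat) * Suc K * Suc (Suc K) = 3 * K * Suc K + (2 * K + 2) * 3"
    by (simp add: algebra_simps)
  hence "q ^ (3 * Suc K * Suc (Suc K)) = q ^ (3 * K * Suc K) * x ^ 3"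
    by (simp only: x_def power_add[of q "3 * K * Suc K"] power_mult[of q "2 * K + 2"])
  hence post: "(-1) ^ Suc K * q ^ (Suc N + 3 * Suc K * Suc (Suc K)) = - e * y * x ^ 3"
    unfolding power_add[of q "Suc N"] by (simp add: e_def y_def del: mult_Suc mult_Suc_right power_Suc add: power_Suc[of "-1"])
  have idx: "2 * Suc K = 2 * K + 2" "2 * K + 2 + 2 = 2 * K + 4" by simp_all
  show ?case
    unfolding sum.atMost_Suc Suc.IH al pre post
    using step unfolding u_def v_def y_def [symmetric] idx by (simp only: mult.assoc)
qed

text \<open>Both sides agree at \<open>N = 0\<close> and satisfy the recurrence of
  \<open>bailey_beta_Suc\<close>. For the sum this is the telescoping identity with upper bound
  \<open>Suc N\<close>, whose certificate vanishes because
  \<open>2 * Suc N + 2 > Suc N\<close>.\<close>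

lemma bailey_pair:
  assumes "norm q < 1" "q \<noteq> 0"
  shows "bailey_beta q N = (\<Sum>n\<le>N. bailey_alpha q n * bailey_kernel q N (2 * n))"
proof (induction N)
  case 0
  show ?case by (simp add: bailey_alpha_def bailey_beta_def bailey_kernel_def)
next
  case (Suc N)
  let ?c = "(1 - q ^ Suc N) * (1 - q ^ (2 * N + 1))"
  have c: "?c \<noteq> 0"
    using one_minus_power_nonzero[OF assms(1), of "Suc N"]
      one_minus_power_nonzero[OF assms(1), of "2 * N + 1"] by simp
  have "(\<Sum>n\<le>Suc N. bailey_alpha q n * (?c * bailey_kernel q (Suc N) (2 * n) - bailey_kernel q N (2 * n))) = 0"
    by (subst bailey_pair_telescope[OF assms]) (simp add: bailey_kernel_eq_0)
  hence "?c * (\<Sum>n\<le>Suc N. bailey_alpha q n * bailey_kernel q (Suc N) (2 * n)) =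
      (\<Sum>n\<le>Suc N. bailey_alpha q n * bailey_kernel q N (2 * n))"
    unfolding right_diff_distrib sum_subtractf sum_distrib_left
    by (simp only: mult_ac right_minus_eq)
  also have "\<dots> = bailey_beta q N"
    by (simp add: bailey_kernel_eq_0 Suc.IH)
  also have "\<dots> = ?c * bailey_beta q (Suc N)"
    by (rule bailey_beta_Suc[OF assms(1), symmetric])
  finally show ?case by (metis c mult_left_cancel)
qed

section \<open>Closed form of the partial sums\<close>

text \<open>Expanding \<open>bailey_beta\<close> and exchanging two finite sums leaves, for each
  \<open>j\<close>, the sum evaluated by \<open>sum_bailey_kernel\<close> at
  \<open>k = 2 * Suc j\<close>.\<close>

lemma bailey_pair_partial_sum:
  assumes "norm q < 1" "q \<noteq> 0"
  shows "(\<Sum>n<N. qpoch q q n ^ 2 * q ^ Suc n * bailey_beta q (Suc n)) =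
           (\<Sum>n<N. q ^ Suc n / (1 - q ^ Suc n)\<^sup>2) +
           (\<Sum>j<N. bailey_alpha q (Suc j) * q ^ (2 * Suc j) / (1 - q ^ (2 * Suc j))\<^sup>2 *
                   (qpoch q q N ^ 2 * bailey_kernel q N (2 * Suc j)))"
proof -
  let ?t = "\<lambda>n k. qpoch q q n ^ 2 * q ^ Suc n * bailey_kernel q (Suc n) k"
  have "qpoch q q n ^ 2 * q ^ Suc n * bailey_beta q (Suc n) =
      q ^ Suc n / (1 - q ^ Suc n)\<^sup>2 + (\<Sum>j<N. bailey_alpha q (Suc j) * ?t n (2 * Suc j))"
    if "n < N" for n
  proof -
    \<comment> \<open>The range is enlarged from \<open>Suc n\<close> to the common bound
      \<open>N\<close> so that the sums can be exchanged; the new terms vanish.\<close>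
    have "bailey_beta q (Suc n) = (\<Sum>j\<le>N. bailey_alpha q j * bailey_kernel q (Suc n) (2 * j))"
      unfolding bailey_pair[OF assms] using that
      by (intro sum.mono_neutral_left) (auto simp: bailey_kernel_eq_0)
    also have "\<dots> = bailey_kernel q (Suc n) 0 +
        (\<Sum>j<N. bailey_alpha q (Suc j) * bailey_kernel q (Suc n) (2 * Suc j))"
      by (subst sum.atMost_shift) (simp add: bailey_alpha_def)
    finally have "qpoch q q n ^ 2 * q ^ Suc n * bailey_beta q (Suc n) =
        ?t n 0 + (\<Sum>j<N. bailey_alpha q (Suc j) * ?t n (2 * Suc j))"
      by (simp only: distrib_left sum_distrib_left mult_ac)
    \<comment> \<open>The case \<open>k = 0\<close> lies outside \<open>sum_bailey_kernel\<close>,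
      but the summand is explicit: both kernel factors are (q)_{n+1}, which is (q)_n times 1 -
      q^(n+1).\<close>
    moreover have "?t n 0 = q ^ Suc n / (1 - q ^ Suc n)\<^sup>2"
      using qpoch_nonzero[OF assms(1) assms(1), of n]
      by (simp add: bailey_kernel_def qpoch_Suc power2_eq_square)
    ultimately show ?thesis by simp
  qed
  hence "(\<Sum>n<N. qpoch q q n ^ 2 * q ^ Suc n * bailey_beta q (Suc n)) =
      (\<Sum>n<N. q ^ Suc n / (1 - q ^ Suc n)\<^sup>2 + (\<Sum>j<N. bailey_alpha q (Suc j) * ?t n (2 * Suc j)))"
    by (intro sum.cong) auto
  also have "\<dots> = (\<Sum>n<N. q ^ Suc n / (1 - q ^ Suc n)\<^sup>2) +
      (\<Sum>j<N. bailey_alpha q (Suc j) * (\<Sum>n<N. ?t n (2 * Suc j)))"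
    unfolding sum.distrib sum_distrib_left by (subst (2) sum.swap) (rule refl)
  also have "(\<Sum>j<N. bailey_alpha q (Suc j) * (\<Sum>n<N. ?t n (2 * Suc j))) =
      (\<Sum>j<N. bailey_alpha q (Suc j) * q ^ (2 * Suc j) / (1 - q ^ (2 * Suc j))\<^sup>2 *
                   (qpoch q q N ^ 2 * bailey_kernel q N (2 * Suc j)))"
  proof (rule sum.cong)
    fix j
    let ?k = "2 * Suc j"
    have "1 - q ^ ?k \<noteq> 0"
      using assms(1) by (intro one_minus_power_nonzero) auto
    hence "(\<Sum>n<N. ?t n ?k) = q ^ ?k * qpoch q q N ^ 2 * bailey_kernel q N ?k / (1 - q ^ ?k)\<^sup>2"
      using sum_bailey_kernel[OF assms(1), of ?k N]
      by (simp add: nonzero_eq_divide_eq mult.commute del: power_Suc mult_Suc_right)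
    thus "bailey_alpha q (Suc j) * (\<Sum>n<N. ?t n ?k) =
        bailey_alpha q (Suc j) * q ^ ?k / (1 - q ^ ?k)\<^sup>2 * (qpoch q q N ^ 2 * bailey_kernel q N ?k)"
      by (simp only: times_divide_eq_left times_divide_eq_right mult_ac)
  qed simp
  finally show ?thesis .
qed

section \<open>Limit and domination of the weights\<close>

text \<open>Shifting \<open>N\<close> by \<open>k\<close> puts the kernel in its nonzero branch; all
  factors then tend to the same nonzero limit and cancel.\<close>

lemma tendsto_qpoch_bailey_kernel:
  assumes "norm q < 1"
  shows "(\<lambda>N. qpoch q q N ^ 2 * bailey_kernel q N k) \<longlonglongrightarrow> 1"
proof (rule LIMSEQ_offset[of _ k])
  let ?E = "qpoch_inf q q"
  note lim = qpoch_tendsto_qpoch_inf[OF assms, of q]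
  note nz = qpoch_inf_nonzero[OF assms assms]
  have "(\<lambda>N. qpoch q q (N + k) ^ 2 * (1 / (qpoch q q N * qpoch q q (N + (k + k)))))
      \<longlonglongrightarrow> ?E ^ 2 * (1 / (?E * ?E))"
    using nz by (intro tendsto_intros lim LIMSEQ_ignore_initial_segment[OF lim]) auto
  also have "?E ^ 2 * (1 / (?E * ?E)) = 1"
    using nz by (simp add: power2_eq_square)
  finally show "(\<lambda>N. qpoch q q (N + k) ^ 2 * bailey_kernel q (N + k) k) \<longlonglongrightarrow> 1"
    by (simp add: bailey_kernel_def add.assoc)
qed

text \<open>A bound uniform in both \<open>N\<close> and \<open>k\<close>, for use in Tannery's
  theorem: (q)_n converges to a nonzero limit, so it and its inverse are bounded.\<close>

lemma qpoch_bailey_kernel_bounded: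
  assumes "norm q < 1"
  obtains M where "\<And>N k. norm (qpoch q q N ^ 2 * bailey_kernel q N k) \<le> M"
proof -
  have lim: "qpoch q q \<longlonglongrightarrow> qpoch_inf q q"
    by (rule qpoch_tendsto_qpoch_inf[OF assms])
  hence "Bseq (qpoch q q)" by (rule convergent_imp_Bseq[OF convergentI])
  then obtain K where K: "K > 0" "\<And>n. norm (qpoch q q n) \<le> K" by (auto elim: BseqE)
  have "(\<lambda>n. inverse (qpoch q q n)) \<longlonglongrightarrow> inverse (qpoch_inf q q)"
    by (intro tendsto_inverse lim qpoch_inf_nonzero assms)
  hence "Bseq (\<lambda>n. inverse (qpoch q q n))" by (rule convergent_imp_Bseq[OF convergentI])
  then obtain L where L: "L > 0" "\<And>n. norm (inverse (qpoch q q n)) \<le> L" by (auto elim: BseqE)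
  have "norm (bailey_kernel q N k) \<le> L * L" for N k
  proof (cases "k \<le> N")
    case True
    hence "norm (bailey_kernel q N k) =
        norm (inverse (qpoch q q (N - k))) * norm (inverse (qpoch q q (N + k)))"
      by (simp add: bailey_kernel_def norm_mult norm_divide norm_inverse divide_inverse)
    also have "\<dots> \<le> L * L" using L by (intro mult_mono) auto
    finally show ?thesis .
  qed (use L in \<open>simp add: bailey_kernel_eq_0\<close>)
  hence "norm (qpoch q q N ^ 2 * bailey_kernel q N k) \<le> K\<^sup>2 * (L * L)" for N k
    unfolding norm_mult norm_power using K by (intro mult_mono power_mono) auto
  thus ?thesis by (rule that)
qed

text \<open>Stated for norms because it yields the Tannery majorant. With r = \<open>norm q\<close>
  the denominator is at least (1 - r)^2 in norm and the exponent at least \<open>n\<close>, so a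
  geometric series dominates.\<close>

lemma summable_norm_theta_term:
  fixes q :: complex
  assumes "norm q < 1"
  shows "summable (\<lambda>n. norm ((-1) ^ Suc n * (1 + q ^ (2 * Suc n)) * q ^ (Suc n * (3 * Suc n + 1)) /
           (1 - q ^ (2 * Suc n))\<^sup>2))"
proof (rule summable_comparison_test'[where N = 0])
  define r where "r = norm q"
  have r: "0 \<le> r" "r < 1" using assms by (auto simp: r_def)
  show "summable (\<lambda>n. 2 / (1 - r)\<^sup>2 * r ^ n)"
    using r by (intro summable_mult summable_geometric) auto
  fix n :: nat
  let ?x = "q ^ (2 * Suc n)"
  have x: "norm ?x \<le> r ^ 1"
    unfolding norm_power r_def [symmetric] using r by (intro power_decreasing) auto
  have "norm (1 + ?x) \<le> 2"
    using norm_triangle_ineq[of 1 ?x] x r by simp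
  moreover have "norm (q ^ (Suc n * (3 * Suc n + 1))) \<le> r ^ n"
    unfolding norm_power r_def [symmetric] using r by (intro power_decreasing) auto
  moreover have "1 - r \<le> norm (1 - ?x)"
    using norm_triangle_ineq2[of 1 ?x] x by simp
  ultimately have "norm (1 + ?x) * norm (q ^ (Suc n * (3 * Suc n + 1))) / (norm (1 - ?x))\<^sup>2
      \<le> 2 * r ^ n / (1 - r)\<^sup>2"
    using r by (intro frac_le mult_mono power_mono) auto
  moreover have "norm ((-1 :: complex) ^ Suc n) = 1"
    by (simp add: norm_power)
  ultimately show "norm (norm ((-1) ^ Suc n * (1 + ?x) * q ^ (Suc n * (3 * Suc n + 1)) / (1 - ?x)\<^sup>2))
      \<le> 2 / (1 - r)\<^sup>2 * r ^ n"
    unfolding norm_divide norm_mult norm_power[of "1 - ?x"] by simp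
qed

section \<open>Passage to the limit\<close>

theorem lemma6p1:
  fixes q :: complex
  assumes "norm q < 1"
  shows "let A = (\<lambda>n::nat. q ^ n / ((1 - q ^ n)\<^sup>2 * qpoch (q ^ (n + 1)) q n
                              * qpoch_inf (q ^ (2 * n + 2)) (q\<^sup>2)));
             B = (\<lambda>n::nat. of_nat n * q ^ n / (1 - q ^ n));
             C = (\<lambda>n::nat. (-1) ^ n * (1 + q ^ (2 * n)) * q ^ (n * (3 * n + 1))
                              / (1 - q ^ (2 * n))\<^sup>2)
         in summable (\<lambda>n. A (Suc n)) \<and> summable (\<lambda>n. B (Suc n)) \<and> summable (\<lambda>n. C (Suc n)) \<and>
            (\<Sum>n. A (Suc n)) =
              1 / qpoch_inf (q\<^sup>2) (q\<^sup>2) * (\<Sum>n. B (Suc n))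
              + 1 / qpoch_inf (q\<^sup>2) (q\<^sup>2) * (\<Sum>n. C (Suc n))"
proof (cases "q = 0")
  case True
  \<comment> \<open>Every summand carries a positive power of \<open>q\<close> and vanishes. The
    case is separate because \<open>bailey_pair\<close> rests on cancelling powers of
    \<open>q\<close>.\<close>
  thus ?thesis by (simp add: Let_def power_0_left)
next
  case False
  define A where "A = (\<lambda>n::nat. q ^ n / ((1 - q ^ n)\<^sup>2 * qpoch (q ^ (n + 1)) q n
                              * qpoch_inf (q ^ (2 * n + 2)) (q\<^sup>2)))"
  define B where "B = (\<lambda>n::nat. of_nat n * q ^ n / (1 - q ^ n))"
  define C where "C = (\<lambda>n::nat. (-1) ^ n * (1 + q ^ (2 * n)) * q ^ (n * (3 * n + 1))
                              / (1 - q ^ (2 * n))\<^sup>2)"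
  define E where "E = qpoch_inf (q\<^sup>2) (q\<^sup>2)"
  define w where "w = (\<lambda>N k. qpoch q q N ^ 2 * bailey_kernel q N k)"
  have q2: "norm (q\<^sup>2) < 1"
    using assms by (simp add: norm_power abs_square_less_1)
  have E0: "E \<noteq> 0" unfolding E_def by (rule qpoch_inf_nonzero[OF q2 q2])
  obtain S where S: "(\<lambda>n. q ^ Suc n / (1 - q ^ Suc n)\<^sup>2) sums S" "(\<lambda>n. B (Suc n)) sums S"
    unfolding B_def by (rule sum_n_pow_div_eq_Lambert[OF assms])
  have normC: "summable (\<lambda>n. norm (C (Suc n)))"
    unfolding C_def by (rule summable_norm_theta_term[OF assms])
  hence sumC: "summable (\<lambda>n. C (Suc n))" by (rule summable_norm_cancel)
  have limC: "(\<lambda>N. \<Sum>j<N. C (Suc j) * w N (2 * Suc j)) \<longlonglongrightarrow> (\<Sum>j. C (Suc j))"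
  proof -
    obtain M where M: "\<And>N k. norm (w N k) \<le> M"
      unfolding w_def using qpoch_bailey_kernel_bounded[OF assms] by blast
    \<comment> \<open>Tannery's theorem is applied to the full series; its terms with
      \<open>j \<ge> N\<close> vanish because \<open>2 * Suc j > N\<close>.\<close>
    have "(\<lambda>N. \<Sum>j. C (Suc j) * w N (2 * Suc j)) \<longlonglongrightarrow> (\<Sum>j. C (Suc j))"
    proof (rule tannerys_theorem[THEN conjunct2, THEN conjunct2])
      show "(\<lambda>N. C (Suc j) * w N (2 * Suc j)) \<longlonglongrightarrow> C (Suc j)" for j
        using tendsto_mult[OF tendsto_const[of "C (Suc j)"]
            tendsto_qpoch_bailey_kernel[OF assms, of "2 * Suc j"]] by (simp add: w_def)
      show "\<forall>\<^sub>F (j, N) in at_top \<times>\<^sub>F sequentially.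
          norm (C (Suc j) * w N (2 * Suc j)) \<le> norm (C (Suc j)) * M"
        by (intro always_eventually) (auto simp: norm_mult intro!: mult_left_mono M)
      show "summable (\<lambda>j. norm (C (Suc j)) * M)"
        by (intro summable_mult2 normC)
    qed simp
    moreover have "(\<Sum>j. C (Suc j) * w N (2 * Suc j)) = (\<Sum>j<N. C (Suc j) * w N (2 * Suc j))" for N
      by (intro suminf_finite) (auto simp: w_def bailey_kernel_eq_0)
    ultimately show ?thesis by simp
  qed
  \<comment> \<open>The factor \<open>q ^ (2 * Suc j)\<close> left by the telescoped sum raises the
    exponent n(3n-1) of \<open>bailey_alpha\<close> to n(3n+1).\<close>
  have C_alpha: "C (Suc j) = bailey_alpha q (Suc j) * q ^ (2 * Suc j) / (1 - q ^ (2 * Suc j))\<^sup>2" for j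
  proof -
    have "Suc j * (3 * Suc j + 1) = Suc j * (3 * Suc j - 1) + 2 * Suc j"
      by (simp add: algebra_simps)
    hence "q ^ (Suc j * (3 * Suc j + 1)) = q ^ (Suc j * (3 * Suc j - 1)) * q ^ (2 * Suc j)"
      by (simp only: power_add)
    thus ?thesis by (simp add: C_def bailey_alpha_def mult_ac del: power_Suc mult_Suc mult_Suc_right)
  qed
  \<comment> \<open>Uses (q^(m+1);q)_m = (q)_{2m} / (q)_m and (q^(2m+2);q^2)_\<infinity> =
    \<open>E\<close> / (q^2;q^2)_m for m = n + 1; the squared denominator turns (q)_m^2 into
    (q)_{m-1}^2.\<close>
  have A_beta: "A (Suc n) = 1 / E * (qpoch q q n ^ 2 * q ^ Suc n * bailey_beta q (Suc n))" for n
  proof -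
    let ?m = "Suc n"
    define z where "z = 1 - q ^ ?m"
    have nz: "qpoch q q n \<noteq> 0" "qpoch q q (2 * ?m) \<noteq> 0" "z \<noteq> 0"
      "qpoch (q\<^sup>2) (q\<^sup>2) ?m \<noteq> 0"
      unfolding z_def using assms q2 qpoch_nonzero one_minus_power_nonzero by blast+
    have P: "qpoch q q ?m = qpoch q q n * z"
      by (simp add: qpoch_Suc z_def)
    have "qpoch q q (2 * ?m) = qpoch q q ?m * qpoch (q ^ (?m + 1)) q ?m"
      using qpoch_add[of q q ?m ?m] by (simp add: mult_2)
    hence Q: "qpoch (q ^ (?m + 1)) q ?m = qpoch q q (2 * ?m) / (qpoch q q n * z)"
      unfolding P using nz by (simp add: field_simps del: power_Suc)
    have "q\<^sup>2 * (q\<^sup>2) ^ ?m = q ^ (2 * ?m + 2)"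
      by (simp only: power_mult [symmetric] power_add mult.commute)
    hence "E = qpoch (q\<^sup>2) (q\<^sup>2) ?m * qpoch_inf (q ^ (2 * ?m + 2)) (q\<^sup>2)"
      using qpoch_inf_split[OF q2, of "q\<^sup>2" ?m] by (simp only: E_def)
    hence R: "qpoch_inf (q ^ (2 * ?m + 2)) (q\<^sup>2) = E / qpoch (q\<^sup>2) (q\<^sup>2) ?m"
      using nz by (simp only: nonzero_eq_divide_eq mult.commute not_False_eq_True)
    show ?thesis
      unfolding A_def bailey_beta_def Q R P z_def [symmetric] using nz E0
      by (simp add: field_simps power2_eq_square del: power_Suc mult_Suc_right)
  qed
  have "(\<lambda>N. 1 / E * ((\<Sum>n<N. q ^ Suc n / (1 - q ^ Suc n)\<^sup>2) + (\<Sum>j<N. C (Suc j) * w N (2 * Suc j))))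
      \<longlonglongrightarrow> 1 / E * (S + (\<Sum>j. C (Suc j)))"
    using S(1) limC unfolding sums_def by (intro tendsto_intros)
  hence "(\<lambda>n. A (Suc n)) sums (1 / E * (S + (\<Sum>j. C (Suc j))))"
    unfolding sums_def A_beta C_alpha w_def sum_distrib_left [symmetric]
      bailey_pair_partial_sum[OF assms False] .
  hence "summable (\<lambda>n. A (Suc n)) \<and> summable (\<lambda>n. B (Suc n)) \<and> summable (\<lambda>n. C (Suc n)) \<and>
      (\<Sum>n. A (Suc n)) = 1 / E * (\<Sum>n. B (Suc n)) + 1 / E * (\<Sum>n. C (Suc n))"
    using S(2) sumC by (simp add: sums_iff distrib_left)
  thus ?thesis unfolding A_def B_def C_def E_def Let_def .
qed

end
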